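(* Let $k\ge 2$ be an integer and let $H$ be an $n$-vertex $k$-graph. Then the matching polynomial $m_k(H,x)$ is uniquely determined from $\mathcal{C}\left(H,\left\lfloor \frac{k-1}{k}n\right\rfloor+1\right)$. That is, if $H_1$ and $H_2$ are $n$-vertex $k$-graphs with $\mathcal{C}\left(H_1,\left\lfloor \frac{k-1}{k}n\right\rfloor+1\right)=\mathcal{C}\left(H_2,\left\lfloor \frac{k-1}{k}n\right\rfloor+1\right)$, then $m_k(H_1,x)=m_k(H_2,x)$.
   Context: A $k$-graph is a finite $k$-uniform hypergraph: a finite vertex set together with finitely many (hyper)edges, each incident with exactly $k$ distinct vertices. Multi-edges are allowed, i.e. distinct edges may have the same vertex set. A matching is a set of pairwise vertex-disjoint edges. For an $n$-vertex $k$-graph $H$, the matching polynomial is $$m_k(H,x)=\sum_{i=0}^{\lfloor n/k\rfloor}(-1)^i p(H,i)x^{n-ki},$$ where $p(H,i)$ is the number of distinct matchings of $i$ edges in $H$, and $p(H,0)=1$. For $X\subseteq V(H)$, the induced sub-hypergraph $H[X]$ has vertex set $X$ and all edges of $H$ (with multiplicity) whose vertices all lie in $X$. For an integer $t\ge 0$, $\mathcal{C}(H,t)$ is the multiset of induced $t$-vertex sub-$k$-graphs of $H$, regarded as unlabeled, i.e. the multiset of isomorphism classes of $H[X]$ as $X$ ranges over all $t$-element subsets of $V(H)$. *)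

theory Defs
  imports "HOL-Library.Multiset" "HOL-Library.Disjoint_Sets"
    "HOL-Computational_Algebra.Polynomial"
begin

text \<open>
  Edges carry their own labels, so that distinct edges may have the same vertex set.
  The value of \<open>ends\<close> outside \<open>edges\<close> is irrelevant.
\<close>

record ('v, 'e) hypergraph =
  verts :: "'v set"
  edges :: "'e set"
  ends :: "'e \<Rightarrow> 'v set"

locale kgraph =
  fixes k :: nat and H :: "('v, 'e) hypergraph"
  assumes finite_verts: "finite (verts H)"
    and finite_edges: "finite (edges H)"
    and ends_subset: "e \<in> edges H \<Longrightarrow> ends H e \<subseteq> verts H"
    and card_ends: "e \<in> edges H \<Longrightarrow> card (ends H e) = k"

definition matching :: "('v, 'e) hypergraph \<Rightarrow> 'e set \<Rightarrow> bool" where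
  "matching H M \<longleftrightarrow> M \<subseteq> edges H \<and> disjoint_family_on (ends H) M"

definition num_matchings :: "('v, 'e) hypergraph \<Rightarrow> nat \<Rightarrow> nat" where
  "num_matchings H i = card {M. matching H M \<and> card M = i}"

definition matching_poly :: "nat \<Rightarrow> ('v, 'e) hypergraph \<Rightarrow> int poly" where
  "matching_poly k H =
     (\<Sum>i = 0..card (verts H) div k.
        monom ((- 1) ^ i * int (num_matchings H i)) (card (verts H) - k * i))"

definition induced :: "('v, 'e) hypergraph \<Rightarrow> 'v set \<Rightarrow> ('v, 'e) hypergraph" where
  "induced H X = \<lparr>verts = X, edges = {e \<in> edges H. ends H e \<subseteq> X}, ends = ends H\<rparr>"

definition isomorphic :: "('v, 'e) hypergraph \<Rightarrow> ('w, 'f) hypergraph \<Rightarrow> bool" where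
  "isomorphic G H \<longleftrightarrow>
     (\<exists>f g. bij_betw f (verts G) (verts H) \<and> bij_betw g (edges G) (edges H) \<and>
        (\<forall>e \<in> edges G. ends H (g e) = f ` ends G e))"

text \<open>
  An isomorphism class is represented by all its members with natural numbers as vertices
  and edges. Every finite hypergraph has such a copy, so this makes classes of finite
  hypergraphs over different vertex and edge types comparable, and two of them are equal
  iff the hypergraphs are isomorphic (\<open>iso_class_eq_iff\<close> below).
\<close>

definition iso_class :: "('v, 'e) hypergraph \<Rightarrow> (nat, nat) hypergraph set" where
  "iso_class H = {G. isomorphic G H}"

definition induced_deck ::
    "('v, 'e) hypergraph \<Rightarrow> nat \<Rightarrow> (nat, nat) hypergraph set multiset" where
  "induced_deck H t =
     image_mset (\<lambda>X. iso_class (induced H X)) (mset_set {X. X \<subseteq> verts H \<and> card X = t})"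

lemma isomorphic_trans:
  assumes "isomorphic G H" "isomorphic H K"
  shows "isomorphic G K"
proof -
  obtain f g where 1: "bij_betw f (verts G) (verts H)" "bij_betw g (edges G) (edges H)"
    "\<forall>e \<in> edges G. ends H (g e) = f ` ends G e"
    using assms(1) unfolding isomorphic_def by blast
  obtain f' g' where 2: "bij_betw f' (verts H) (verts K)" "bij_betw g' (edges H) (edges K)"
    "\<forall>e \<in> edges H. ends K (g' e) = f' ` ends H e"
    using assms(2) unfolding isomorphic_def by blast
  have "\<forall>e \<in> edges G. ends K ((g' \<circ> g) e) = (f' \<circ> f) ` ends G e"
    using 1 2 by (auto simp: bij_betw_apply image_comp)
  with bij_betw_trans[OF 1(1) 2(1)] bij_betw_trans[OF 1(2) 2(2)] show ?thesis
    unfolding isomorphic_def by blast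
qed

lemma isomorphic_sym:
  assumes "isomorphic G H" and sub: "\<And>e. e \<in> edges G \<Longrightarrow> ends G e \<subseteq> verts G"
  shows "isomorphic H G"
proof -
  obtain f g where f: "bij_betw f (verts G) (verts H)" and g: "bij_betw g (edges G) (edges H)"
    and fg: "\<forall>e \<in> edges G. ends H (g e) = f ` ends G e"
    using assms(1) unfolding isomorphic_def by blast
  let ?f = "inv_into (verts G) f" and ?g = "inv_into (edges G) g"
  have "ends G (?g e) = ?f ` ends H e" if e: "e \<in> edges H" for e
  proof -
    have a: "?g e \<in> edges G" "g (?g e) = e"
      using g e by (auto simp: bij_betw_def inv_into_into f_inv_into_f)
    then have "ends H e = f ` ends G (?g e)"
      using fg by force
    moreover have "?f ` f ` ends G (?g e) = ends G (?g e)"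
      using f sub[OF a(1)] by (simp add: bij_betw_def inv_into_image_cancel)
    ultimately show ?thesis
      by simp
  qed
  with bij_betw_inv_into[OF f] bij_betw_inv_into[OF g] show ?thesis
    unfolding isomorphic_def by blast
qed

lemma isomorphic_nat_copy:
  fixes H :: "('v, 'e) hypergraph"
  assumes "finite (verts H)" "finite (edges H)"
    and sub: "\<And>e. e \<in> edges H \<Longrightarrow> ends H e \<subseteq> verts H"
  obtains G :: "(nat, nat) hypergraph"
  where "isomorphic G H" "\<And>e. e \<in> edges G \<Longrightarrow> ends G e \<subseteq> verts G"
proof -
  obtain f :: "'v \<Rightarrow> nat" where f: "inj_on f (verts H)"
    using assms(1) finite_imp_inj_to_nat_seg by metis
  obtain g :: "'e \<Rightarrow> nat" where g: "inj_on g (edges H)"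
    using assms(2) finite_imp_inj_to_nat_seg by metis
  define G where "G = \<lparr>verts = f ` verts H, edges = g ` edges H,
    ends = (\<lambda>e. f ` ends H (inv_into (edges H) g e))\<rparr>"
  have G: "ends G e \<subseteq> verts G" if "e \<in> edges G" for e
    using that g sub by (fastforce simp: G_def)
  have "isomorphic H G"
    unfolding isomorphic_def
    by (rule exI[of _ f], rule exI[of _ g]) (use f g in \<open>auto simp: G_def bij_betw_def\<close>)
  then have "isomorphic G H"
    using sub by (rule isomorphic_sym)
  then show thesis
    using G by (rule that)
qed

lemma iso_class_eq_iff:
  fixes G :: "('v, 'e) hypergraph" and H :: "('w, 'f) hypergraph"
  assumes "kgraph k G"
  shows "iso_class G = iso_class H \<longleftrightarrow> isomorphic G H"
proof
  assume eq: "iso_class G = iso_class H"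
  obtain K :: "(nat, nat) hypergraph" where K: "isomorphic K G"
    "\<And>e. e \<in> edges K \<Longrightarrow> ends K e \<subseteq> verts K"
    by (rule isomorphic_nat_copy[of G]) (use assms in \<open>simp_all add: kgraph_def\<close>)
  have "K \<in> iso_class H"
    unfolding eq[symmetric] using K(1) by (simp add: iso_class_def)
  then have "isomorphic K H"
    by (simp add: iso_class_def)
  with isomorphic_sym[OF K] show "isomorphic G H"
    by (rule isomorphic_trans)
next
  assume GH: "isomorphic G H"
  have HG: "isomorphic H G"
    using GH by (rule isomorphic_sym) (use assms in \<open>simp add: kgraph_def\<close>)
  have "isomorphic K G \<longleftrightarrow> isomorphic K H" for K :: "(nat, nat) hypergraph"
    using isomorphic_trans[OF _ GH, of K] isomorphic_trans[OF _ HG, of K] by argo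
  then show "iso_class G = iso_class H"
    by (simp add: iso_class_def)
qed

end

theory Submission imports Defs "HOL-Computational_Algebra.Formal_Power_Series" begin

text \<open>
  A matching with \<open>i\<close> edges covers \<open>k * i\<close> vertices, in general far more than the cards of the
  deck have, so matchings cannot simply be counted card by card. A \<^emph>\<open>connected\<close> set of \<open>i\<close> edges,
  however, covers at most \<open>(k - 1) * i + 1\<close> vertices, and for \<open>i \<le> n div k\<close> this is at most the
  size \<open>(k - 1) * n div k + 1\<close> of a card. The proof therefore passes from the matching numbers
  to quantities that are supported on connected edge sets.

  These quantities are the coefficients of the logarithmic derivative \<open>P' / P\<close> of the matching
  generating function \<open>P = (\<Sum>i. p(H, i) * X ^ i)\<close>. Regard \<open>P\<close> as a function of the edge set \<open>S\<close>,
  and expand the coefficient of \<open>X ^ i\<close> in \<open>P' / P\<close> as \<open>\<Sum>T\<in>Pow S. a T\<close>. Two properties of the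
  coefficients \<open>a T\<close> matter.

  \<^item> \<open>a T = 0\<close> if \<open>T\<close> has more than \<open>i + 1\<close> edges (\<open>set_poly_log_deriv_nth\<close>): the coefficient of
    \<open>X ^ j\<close> in \<open>P\<close> counts certain \<open>j\<close>-subsets of \<open>S\<close>, and such degrees add up under products.

  \<^item> \<open>a T = 0\<close> if \<open>T\<close> is disconnected (\<open>additive_coefficient_eq_0\<close>): \<open>P\<close> is multiplicative
    over vertex-disjoint edge sets, hence \<open>P' / P\<close> is additive.

  So \<open>a T \<noteq> 0\<close> forces \<open>T\<close> to cover at most \<open>(k - 1) * (i + 1) + 1\<close> vertices
  (\<open>log_deriv_coefficients\<close>), and it remains to determine the sums \<open>A r\<close> of all \<open>a T\<close> over the
  edge sets \<open>T\<close> that cover exactly \<open>r\<close> vertices, for \<open>r\<close> up to the size of a card. By Kelly's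
  counting argument the deck determines all decks of smaller cards (\<open>induced_deck_eq_smaller\<close>).
  Adding up the \<open>i\<close>-th coefficient of \<open>P' / P\<close> over all cards of size \<open>s\<close> gives a combination of
  \<open>A 0, \<dots>, A s\<close> in which \<open>A s\<close> has the coefficient 1 (\<open>sum_over_levels\<close>), a triangular system
  with a unique solution. Finally, \<open>P' = (P' / P) * P\<close> is a recurrence that returns the matching
  numbers.
\<close>

unbundle fps_syntax

section \<open>Set polynomials\<close>

text \<open>
  The coefficients \<open>a\<close> are those of a multilinear polynomial in the indicator variables of the
  elements, evaluated at the characteristic vector of \<open>S\<close>; \<open>d\<close> bounds its total degree.
\<close>

definition set_poly :: "nat \<Rightarrow> ('e set \<Rightarrow> real) \<Rightarrow> bool" where
  "set_poly d f \<longleftrightarrow>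
     (\<exists>a. (\<forall>T. card T > d \<longrightarrow> a T = 0) \<and> (\<forall>S. finite S \<longrightarrow> f S = (\<Sum>T\<in>Pow S. a T)))"

lemma set_poly_cong:
  assumes "set_poly d f" "\<And>S. finite S \<Longrightarrow> f S = g S"
  shows "set_poly d g"
  using assms unfolding set_poly_def by metis

lemma set_poly_cmult:
  assumes "set_poly d f"
  shows "set_poly d (\<lambda>S. c * f S)"
proof -
  obtain a where "\<forall>T. card T > d \<longrightarrow> a T = 0" "\<forall>S. finite S \<longrightarrow> f S = (\<Sum>T\<in>Pow S. a T)"
    using assms unfolding set_poly_def by blast
  then show ?thesis
    unfolding set_poly_def by (intro exI[of _ "\<lambda>T. c * a T"]) (simp add: sum_distrib_left)
qed

lemma set_poly_diff:
  assumes "set_poly d f" "set_poly d g"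
  shows "set_poly d (\<lambda>S. f S - g S)"
proof -
  obtain a b where "\<forall>T. card T > d \<longrightarrow> a T = 0" "\<forall>S. finite S \<longrightarrow> f S = (\<Sum>T\<in>Pow S. a T)"
    "\<forall>T. card T > d \<longrightarrow> b T = 0" "\<forall>S. finite S \<longrightarrow> g S = (\<Sum>T\<in>Pow S. b T)"
    using assms unfolding set_poly_def by metis
  then show ?thesis
    unfolding set_poly_def by (intro exI[of _ "\<lambda>T. a T - b T"]) (simp add: sum_subtractf)
qed

lemma set_poly_sum:
  assumes "finite J" "\<And>j. j \<in> J \<Longrightarrow> set_poly d (f j)"
  shows "set_poly d (\<lambda>S. \<Sum>j\<in>J. f j S)"
proof -
  obtain a where "\<And>j T. j \<in> J \<Longrightarrow> card T > d \<Longrightarrow> a j T = 0"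
    "\<And>j S. j \<in> J \<Longrightarrow> finite S \<Longrightarrow> f j S = (\<Sum>T\<in>Pow S. a j T)"
    using assms(2) unfolding set_poly_def by metis
  then show ?thesis
    unfolding set_poly_def
    by (intro exI[of _ "\<lambda>T. \<Sum>j\<in>J. a j T"]) (simp add: sum.swap[of _ J])
qed

text \<open>
  The monomials of \<open>T\<close> and \<open>U\<close> multiply to that of \<open>T \<union> U\<close>, since indicator variables are
  idempotent; the coefficient of \<open>W\<close> in the product therefore collects all pairs with union \<open>W\<close>.
\<close>

lemma set_poly_mult:
  assumes "set_poly d f" "set_poly d' g"
  shows "set_poly (d + d') (\<lambda>S. f S * g S)"
proof -
  obtain a b where a: "\<And>T. card T > d \<Longrightarrow> a T = 0"
    and f: "\<And>S. finite S \<Longrightarrow> f S = (\<Sum>T\<in>Pow S. a T)"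
    and b: "\<And>T. card T > d' \<Longrightarrow> b T = 0"
    and g: "\<And>S. finite S \<Longrightarrow> g S = (\<Sum>T\<in>Pow S. b T)"
    using assms unfolding set_poly_def by metis
  define pairs :: "'a set \<Rightarrow> ('a set \<times> 'a set) set"
    where "pairs W = {x \<in> Pow W \<times> Pow W. fst x \<union> snd x = W}" for W
  define c where "c W = (\<Sum>(T, U)\<in>pairs W. a T * b U)" for W
  have "c W = 0" if "card W > d + d'" for W
    unfolding c_def
  proof (rule sum.neutral, clarify)
    fix T U assume "(T, U) \<in> pairs W"
    then have "card W \<le> card T + card U"
      unfolding pairs_def using card_Un_le[of T U] by simp
    with that have "card T > d \<or> card U > d'"
      by linarith
    then show "a T * b U = 0"
      using a b by auto
  qed
  moreover have "f S * g S = (\<Sum>W\<in>Pow S. c W)" if S: "finite S" for S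
  proof -
    have "f S * g S = (\<Sum>(T, U)\<in>Pow S \<times> Pow S. a T * b U)"
      using S by (simp add: f g sum_product sum.cartesian_product)
    also have "\<dots> = (\<Sum>W\<in>Pow S. \<Sum>(T, U)\<in>{x \<in> Pow S \<times> Pow S. fst x \<union> snd x = W}. a T * b U)"
      by (rule sum.group[symmetric]) (use S in auto)
    also have "\<dots> = (\<Sum>W\<in>Pow S. c W)"
      unfolding c_def by (intro sum.cong) (auto simp: pairs_def)
    finally show ?thesis .
  qed
  ultimately show ?thesis
    unfolding set_poly_def by blast
qed

section \<open>The logarithmic derivative of the matching generating function\<close>

definition match_fps :: "('e \<Rightarrow> 'v set) \<Rightarrow> 'e set \<Rightarrow> real fps" where
  "match_fps v S = (\<Sum>M | M \<subseteq> S \<and> disjoint_family_on v M. fps_X ^ card M)"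

definition log_deriv :: "('e \<Rightarrow> 'v set) \<Rightarrow> 'e set \<Rightarrow> real fps" where
  "log_deriv v S = fps_deriv (match_fps v S) * inverse (match_fps v S)"

definition separated :: "('e \<Rightarrow> 'v set) \<Rightarrow> 'e set \<Rightarrow> 'e set \<Rightarrow> bool" where
  "separated v A B \<longleftrightarrow> A \<inter> B = {} \<and> (\<forall>x\<in>A. \<forall>y\<in>B. v x \<inter> v y = {})"

lemma match_fps_nth:
  assumes "finite S"
  shows "match_fps v S $ i = real (card {M. (M \<subseteq> S \<and> disjoint_family_on v M) \<and> card M = i})"
proof -
  have fin: "finite {M. M \<subseteq> S \<and> disjoint_family_on v M}"
    using assms by (auto intro: finite_subset[of _ "Pow S"])
  have "match_fps v S $ i
      = (\<Sum>M | M \<subseteq> S \<and> disjoint_family_on v M. if card M = i then 1 else 0)"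
    unfolding match_fps_def fps_sum_nth by (intro sum.cong) auto
  also have "\<dots> = real (card {M. (M \<subseteq> S \<and> disjoint_family_on v M) \<and> card M = i})"
    using fin by (simp flip: sum.inter_filter)
  finally show ?thesis .
qed

lemma match_fps_nth_0 [simp]:
  assumes "finite S"
  shows "match_fps v S $ 0 = 1"
proof -
  have "{M. (M \<subseteq> S \<and> disjoint_family_on v M) \<and> card M = 0} = {{}}"
    using assms by (auto dest: finite_subset simp: disjoint_family_on_def)
  then show ?thesis
    using assms by (simp add: match_fps_nth)
qed

lemma num_matchings_eq_match_fps_nth:
  assumes "finite (edges H)"
  shows "real (num_matchings H i) = match_fps (ends H) (edges H) $ i"
  using assms by (simp add: match_fps_nth num_matchings_def matching_def)

text \<open>
  A matching in \<open>A \<union> B\<close> amounts to a free choice of a matching in \<open>A\<close> and one in \<open>B\<close>.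
\<close>

lemma match_fps_separated:
  assumes "finite A" "finite B" and sep: "separated v A B"
  shows "match_fps v (A \<union> B) = match_fps v A * match_fps v B"
proof -
  define Ms where "Ms S = {M. M \<subseteq> S \<and> disjoint_family_on v M}" for S
  have "match_fps v A * match_fps v B
      = (\<Sum>(M, N)\<in>Ms A \<times> Ms B. fps_X ^ card M * fps_X ^ card N)"
    by (simp add: match_fps_def Ms_def sum_product sum.cartesian_product)
  also have "\<dots> = (\<Sum>M\<in>Ms (A \<union> B). fps_X ^ card M)"
  proof (rule sum.reindex_bij_witness[of _ "\<lambda>M. (M \<inter> A, M \<inter> B)" "\<lambda>(M, N). M \<union> N"], goal_cases)
    case (1 x)
    then show ?case
      using sep by (auto simp: Ms_def separated_def)
  next
    case (2 x)
    obtain M N where x: "x = (M, N)" by force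
    have MN: "M \<subseteq> A" "N \<subseteq> B" "disjoint_family_on v M" "disjoint_family_on v N"
      using 2 by (auto simp: x Ms_def)
    have "v p \<inter> v q = {}" if pq: "p \<in> M \<union> N" "q \<in> M \<union> N" "p \<noteq> q" for p q
    proof -
      consider "p \<in> M" "q \<in> M" | "p \<in> N" "q \<in> N" | "p \<in> A" "q \<in> B" | "q \<in> A" "p \<in> B"
        using pq MN by blast
      then show ?thesis
        using MN(3,4) pq(3) sep unfolding separated_def disjoint_family_on_def by cases blast+
    qed
    then show ?case
      using MN by (auto simp: x Ms_def disjoint_family_on_def)
  next
    case (3 M)
    then show ?case
      by (auto simp: Ms_def)
  next
    case (4 M)
    then show ?case
      by (auto simp: Ms_def disjoint_family_on_def)
  next
    case (5 x)
    obtain M N where x: "x = (M, N)" by force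
    have "card (M \<union> N) = card M + card N"
      using 5 sep assms unfolding x Ms_def separated_def
      by (intro card_Un_disjoint) (auto intro: finite_subset)
    then show ?case
      by (simp add: x power_add)
  qed
  finally show ?thesis
    by (simp add: match_fps_def Ms_def)
qed

lemma log_deriv_separated:
  assumes "finite A" "finite B" "separated v A B"
  shows "log_deriv v (A \<union> B) = log_deriv v A + log_deriv v B"
proof -
  have [simp]: "inverse (match_fps v A) * match_fps v A = 1"
     "inverse (match_fps v B) * match_fps v B = 1"
    using assms by (simp_all add: inverse_mult_eq_1)
  have "log_deriv v (A \<union> B)
     = fps_deriv (match_fps v A) * inverse (match_fps v A) * (inverse (match_fps v B) * match_fps v B)
     + fps_deriv (match_fps v B) * inverse (match_fps v B) * (inverse (match_fps v A) * match_fps v A)"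
    by (simp only: log_deriv_def match_fps_separated[OF assms] fps_deriv_mult fps_inverse_mult)
       (simp only: algebra_simps)
  then show ?thesis
    by (simp add: log_deriv_def)
qed

text \<open>
  This is \<open>P' = (P' / P) * P\<close>, read coefficientwise. The summand \<open>j = i\<close> stands apart, with
  \<open>P $ 0 = 1\<close>, so that the equation can be solved for \<open>P $ (i + 1)\<close> as well as for the
  \<open>i\<close>-th coefficient of \<open>P' / P\<close>.
\<close>

lemma match_fps_recurrence:
  assumes "finite S"
  shows "real (i + 1) * match_fps v S $ (i + 1)
    = (\<Sum>j<i. log_deriv v S $ j * match_fps v S $ (i - j)) + log_deriv v S $ i"
proof -
  have "inverse (match_fps v S) * match_fps v S = 1"
    using assms by (simp add: inverse_mult_eq_1)
  then have "fps_deriv (match_fps v S) = log_deriv v S * match_fps v S"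
    by (simp add: log_deriv_def mult.assoc)
  then have "fps_deriv (match_fps v S) $ i = (\<Sum>j=0..i. log_deriv v S $ j * match_fps v S $ (i - j))"
    by (simp add: fps_mult_nth)
  also have "{0..i} = insert i {..<i}"
    by auto
  finally show ?thesis
    using assms by simp
qed

lemma set_poly_match_fps_nth: "set_poly i (\<lambda>S. match_fps v S $ i)"
proof -
  let ?a = "\<lambda>T. if disjoint_family_on v T \<and> card T = i then 1 else (0::real)"
  have "match_fps v S $ i = (\<Sum>T\<in>Pow S. ?a T)" if "finite S" for S
  proof -
    have "{M. (M \<subseteq> S \<and> disjoint_family_on v M) \<and> card M = i}
        = {M \<in> Pow S. disjoint_family_on v M \<and> card M = i}"
      by auto
    then show ?thesis
      using that by (simp add: match_fps_nth flip: sum.inter_filter)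
  qed
  then show ?thesis
    unfolding set_poly_def by (intro exI[of _ ?a]) auto
qed

text \<open>
  By induction on the recurrence: \<open>i + 1\<close> bounds the degree of \<open>P $ (i + 1)\<close>, and
  \<open>(j + 1) + (i - j)\<close> that of the products.
\<close>

lemma set_poly_log_deriv_nth: "set_poly (i + 1) (\<lambda>S. log_deriv v S $ i)"
proof (induction i rule: less_induct)
  case (less i)
  have "set_poly (i + 1) (\<lambda>S. log_deriv v S $ j * match_fps v S $ (i - j))" if "j < i" for j
    using set_poly_mult[OF less[OF that] set_poly_match_fps_nth[of "i - j" v]] that by simp
  then have "set_poly (i + 1) (\<lambda>S. real (i + 1) * match_fps v S $ (i + 1)
      - (\<Sum>j<i. log_deriv v S $ j * match_fps v S $ (i - j)))"
    by (intro set_poly_diff set_poly_cmult set_poly_sum set_poly_match_fps_nth) auto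
  then show ?case
    by (rule set_poly_cong) (subst match_fps_recurrence, auto)
qed

text \<open>
  An additive function has no mixed terms. By induction on the size of \<open>A \<union> B\<close>, a proper subset
  of \<open>A \<union> B\<close> that meets both parts is itself a separated union and contributes nothing to
  \<open>f (A \<union> B)\<close>; the subsets of \<open>A\<close> and of \<open>B\<close> already account for \<open>f A + f B\<close>, and only
  \<open>a (A \<union> B)\<close> is left.
\<close>

lemma additive_coefficient_eq_0:
  fixes f a :: "'e set \<Rightarrow> real"
  assumes f: "\<And>S. finite S \<Longrightarrow> f S = (\<Sum>T\<in>Pow S. a T)"
    and add: "\<And>A B. finite A \<Longrightarrow> finite B \<Longrightarrow> separated v A B \<Longrightarrow> f (A \<union> B) = f A + f B"
    and "finite A" "finite B" "separated v A B" "A \<noteq> {}" "B \<noteq> {}"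
  shows "a (A \<union> B) = 0"
  using assms(3-)
proof (induction "card (A \<union> B)" arbitrary: A B rule: less_induct)
  case less
  have AB: "A \<inter> B = {}"
    using less.prems by (simp add: separated_def)
  have "f {} = f {} + f {}"
    using add[of "{}" "{}"] by (simp add: separated_def)
  then have a0: "a {} = 0"
    using f[of "{}"] by simp
  have mixed: "a T = 0" if T: "T \<in> Pow (A \<union> B) - (Pow A \<union> Pow B) - {A \<union> B}" for T
  proof -
    have "a (T \<inter> A \<union> T \<inter> B) = 0"
    proof (rule less.hyps)
      have "T \<inter> A \<union> T \<inter> B \<subset> A \<union> B"
        using T by auto
      then show "card (T \<inter> A \<union> T \<inter> B) < card (A \<union> B)"
        using less.prems by (intro psubset_card_mono) auto
      show "separated v (T \<inter> A) (T \<inter> B)"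
        using less.prems by (auto simp: separated_def)
    qed (use T less.prems in auto)
    also have "T \<inter> A \<union> T \<inter> B = T"
      using T by auto
    finally show ?thesis .
  qed
  have "f (A \<union> B) = (\<Sum>T\<in>Pow (A \<union> B) - (Pow A \<union> Pow B). a T) + (\<Sum>T\<in>Pow A \<union> Pow B. a T)"
    using less.prems by (subst f, simp, intro sum.subset_diff) auto
  also have "(\<Sum>T\<in>Pow (A \<union> B) - (Pow A \<union> Pow B). a T) = a (A \<union> B)"
    using less.prems AB mixed by (subst sum.remove[of _ "A \<union> B"]) (auto intro!: sum.neutral)
  also have "(\<Sum>T\<in>Pow A \<union> Pow B. a T) = f A + f B - (\<Sum>T\<in>Pow A \<inter> Pow B. a T)"
    using less.prems by (subst sum_Un) (auto simp: f)
  also have "Pow A \<inter> Pow B = {{}}"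
    using AB by auto
  finally show ?case
    using add[of A B] less.prems a0 by simp
qed

section \<open>Connected edge sets\<close>

text \<open>
  Build \<open>S\<close> up edge by edge, starting from any edge: by connectedness there is always a next edge
  that meets the vertices already covered, and it covers at most \<open>k - 1\<close> new ones. The proof
  takes a maximal subset that satisfies the bound.
\<close>

lemma card_Union_connected_le:
  assumes "finite S" "S \<noteq> {}" and k: "\<And>e. e \<in> S \<Longrightarrow> finite (v e) \<and> card (v e) = k"
    and conn: "\<And>A B. S = A \<union> B \<Longrightarrow> separated v A B \<Longrightarrow> A = {} \<or> B = {}"
  shows "card (\<Union>(v ` S)) \<le> (k - 1) * card S + 1"
proof -
  define good where "good A \<longleftrightarrow> A \<noteq> {} \<and> card (\<Union>(v ` A)) \<le> (k - 1) * card A + 1" for A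
  obtain e where "e \<in> S"
    using assms(2) by blast
  then have "good {e}"
    using k[of e] by (simp add: good_def)
  then have "\<exists>A\<in>{A \<in> Pow S. good A}. \<forall>B\<in>{A \<in> Pow S. good A}. A \<subseteq> B \<longrightarrow> A = B"
    using \<open>e \<in> S\<close> assms(1) by (intro finite_has_maximal) auto
  then obtain A where A: "A \<subseteq> S" "good A"
    and max: "\<And>B. B \<subseteq> S \<Longrightarrow> good B \<Longrightarrow> A \<subseteq> B \<Longrightarrow> A = B"
    by auto
  \<comment> \<open>Otherwise some edge outside \<open>A\<close> meets an edge of \<open>A\<close> and could be added.\<close>
  have "A = S"
  proof (rule ccontr)
    assume "A \<noteq> S"
    then have "\<not> separated v A (S - A)"
      using conn[of A "S - A"] A by (auto simp: good_def)
    then obtain x y where xy: "x \<in> A" "y \<in> S" "y \<notin> A" "v x \<inter> v y \<noteq> {}"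
      unfolding separated_def by auto
    have fin: "finite A" "finite (\<Union>(v ` A))"
      using A assms(1) k by (auto intro: finite_subset)
    have "v y - \<Union>(v ` A) \<subset> v y"
      using xy by auto
    then have "card (v y - \<Union>(v ` A)) < k"
      using k[OF xy(2)] psubset_card_mono by metis
    moreover have "card (\<Union>(v ` insert y A)) \<le> card (v y - \<Union>(v ` A)) + card (\<Union>(v ` A))"
      using card_Un_le[of "v y - \<Union>(v ` A)" "\<Union>(v ` A)"] by (simp add: Un_Diff_cancel2)
    ultimately have "good (insert y A)"
      using A(2) fin(1) xy(3) by (simp add: good_def)
    then show False
      using max[of "insert y A"] A(1) xy by auto
  qed
  then show ?thesis
    using A by (simp add: good_def)
qed

text \<open>
  A set \<open>T\<close> with \<open>a T \<noteq> 0\<close> is connected and has at most \<open>i + 1\<close> edges.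
\<close>

lemma log_deriv_coefficients:
  obtains a where "\<And>S. finite S \<Longrightarrow> log_deriv v S $ i = (\<Sum>T\<in>Pow S. a T)"
    and "\<And>T. finite T \<Longrightarrow> \<forall>e\<in>T. finite (v e) \<and> card (v e) = k \<Longrightarrow>
           card (\<Union>(v ` T)) > (k - 1) * (i + 1) + 1 \<Longrightarrow> a T = 0"
proof -
  obtain a where a0: "\<And>T. card T > i + 1 \<Longrightarrow> a T = 0"
    and a: "\<And>S. finite S \<Longrightarrow> log_deriv v S $ i = (\<Sum>T\<in>Pow S. a T)"
    using set_poly_log_deriv_nth[of i v] unfolding set_poly_def by blast
  have "a T = 0" if T: "finite T" "\<forall>e\<in>T. finite (v e) \<and> card (v e) = k"
     and large: "card (\<Union>(v ` T)) > (k - 1) * (i + 1) + 1" for T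
  proof (rule ccontr)
    assume nz: "a T \<noteq> 0"
    then have "card T \<le> i + 1"
      using a0 by (meson not_le)
    moreover have "card (\<Union>(v ` T)) \<le> (k - 1) * card T + 1"
    proof (rule card_Union_connected_le)
      fix A B assume AB: "T = A \<union> B" "separated v A B"
      show "A = {} \<or> B = {}"
      proof (rule ccontr)
        assume "\<not> ?thesis"
        then have "a (A \<union> B) = 0"
          using AB T(1)
          by (intro additive_coefficient_eq_0[of "\<lambda>S. log_deriv v S $ i" a v])
             (auto simp: a log_deriv_separated)
        then show False
          using nz AB by simp
      qed
    qed (use T large in auto)
    ultimately show False
      using large mult_le_mono2[of "card T" "i + 1" "k - 1"] by linarith
  qed
  with a show thesis
    by (rule that)
qed

section \<open>Isomorphism and Kelly's lemma for decks\<close>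

lemma card_intermediate_sets:
  assumes "finite V" "U \<subseteq> V" "card U \<le> s"
  shows "card {Y. U \<subseteq> Y \<and> Y \<subseteq> V \<and> card Y = s} = (card V - card U) choose (s - card U)"
proof -
  have fU: "finite U"
    using assms finite_subset by blast
  have "bij_betw (\<lambda>Z. U \<union> Z) {Z. Z \<subseteq> V - U \<and> card Z = s - card U} {Y. U \<subseteq> Y \<and> Y \<subseteq> V \<and> card Y = s}"
  proof (rule bij_betw_byWitness[where f' = "\<lambda>Y. Y - U"])
    show "(\<lambda>Z. U \<union> Z) ` {Z. Z \<subseteq> V - U \<and> card Z = s - card U} \<subseteq> {Y. U \<subseteq> Y \<and> Y \<subseteq> V \<and> card Y = s}"
    proof (clarsimp, intro conjI)
      fix Z assume Z: "Z \<subseteq> V - U" "card Z = s - card U"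
      then have "card (U \<union> Z) = card U + card Z"
        using assms fU by (intro card_Un_disjoint) (auto intro: finite_subset)
      then show "card (U \<union> Z) = s"
        using Z assms by simp
    qed (use assms in auto)
    show "(\<lambda>Y. Y - U) ` {Y. U \<subseteq> Y \<and> Y \<subseteq> V \<and> card Y = s} \<subseteq> {Z. Z \<subseteq> V - U \<and> card Z = s - card U}"
      using fU by (auto simp: card_Diff_subset)
  qed auto
  then have "card {Z. Z \<subseteq> V - U \<and> card Z = s - card U} = card {Y. U \<subseteq> Y \<and> Y \<subseteq> V \<and> card Y = s}"
    by (rule bij_betw_same_card)
  moreover have "card {Z. Z \<subseteq> V - U \<and> card Z = s - card U} = card (V - U) choose (s - card U)"
    using assms(1) by (intro n_subsets) simp
  ultimately show ?thesis
    using assms fU by (simp add: card_Diff_subset)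
qed

text \<open>
  An isomorphism acts on sets of vertices and on sets of edges; this transports whatever families
  of such sets it respects.
\<close>

lemma bij_betw_image_subsets:
  assumes "bij_betw f A B" and PQ: "\<And>X. X \<subseteq> A \<Longrightarrow> Q (f ` X) \<longleftrightarrow> P X"
  shows "bij_betw ((`) f) {X. X \<subseteq> A \<and> P X} {Y. Y \<subseteq> B \<and> Q Y}"
proof -
  have Pow: "bij_betw ((`) f) (Pow A) (Pow B)"
    using assms(1) by (rule bij_betw_Pow)
  have "{Y. Y \<subseteq> B \<and> Q Y} = {Y \<in> (`) f ` Pow A. Q Y}"
    unfolding bij_betw_imp_surj_on[OF Pow] by auto
  also have "\<dots> = (`) f ` {X. X \<subseteq> A \<and> P X}"
    using PQ by auto
  finally show ?thesis
    using inj_on_subset[OF bij_betw_imp_inj_on[OF Pow], of "{X. X \<subseteq> A \<and> P X}"]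
    by (auto simp: bij_betw_def)
qed

lemma induced_induced: "induced (induced H Z) Y = induced H Y" if "Y \<subseteq> Z"
  using that by (auto simp: induced_def)

lemma kgraph_induced:
  assumes "kgraph k H" "X \<subseteq> verts H"
  shows "kgraph k (induced H X)"
  using assms by (auto simp: kgraph_def induced_def intro: finite_subset)

lemma induced_deck_isomorphic:
  assumes G: "kgraph k G" and "isomorphic G H"
  shows "induced_deck G s = induced_deck H s"
proof -
  obtain f g where f: "bij_betw f (verts G) (verts H)" and g: "bij_betw g (edges G) (edges H)"
    and fg: "\<And>e. e \<in> edges G \<Longrightarrow> ends H (g e) = f ` ends G e"
    using assms(2) unfolding isomorphic_def by blast
  let ?C = "\<lambda>G. {X. X \<subseteq> verts G \<and> card X = s}"
  have inj: "inj_on f (verts G)"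
    using f by (simp add: bij_betw_def)
  have iso: "iso_class (induced G X) = iso_class (induced H (f ` X))" if X: "X \<subseteq> verts G" for X
  proof -
    have sub: "f ` ends G e \<subseteq> f ` X \<longleftrightarrow> ends G e \<subseteq> X" if "e \<in> edges G" for e
    proof -
      have "ends G e \<subseteq> verts G"
        using G that by (simp add: kgraph_def)
      then show ?thesis
        unfolding image_subset_iff using inj_on_image_mem_iff[OF inj _ X] by blast
    qed
    have "bij_betw g {e \<in> edges G. ends G e \<subseteq> X} {e \<in> edges H. ends H e \<subseteq> f ` X}"
    proof -
      have "{e \<in> edges G. ends G e \<subseteq> X} = {e \<in> edges G. ends H (g e) \<subseteq> f ` X}"
        using fg sub by (intro Collect_cong conj_cong refl) simp
      moreover have "g ` {e \<in> edges G. ends H (g e) \<subseteq> f ` X} = {e \<in> edges H. ends H e \<subseteq> f ` X}"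
        by (auto simp flip: bij_betw_imp_surj_on[OF g])
      moreover have "inj_on g {e \<in> edges G. ends H (g e) \<subseteq> f ` X}"
        by (rule inj_on_subset[OF bij_betw_imp_inj_on[OF g]]) blast
      ultimately show ?thesis
        by (simp add: bij_betw_def)
    qed
    moreover have "bij_betw f X (f ` X)"
      using inj X by (auto intro: inj_on_imp_bij_betw inj_on_subset)
    ultimately have "isomorphic (induced G X) (induced H (f ` X))"
      unfolding isomorphic_def induced_def using fg
      by (intro exI[of _ f] exI[of _ g]) auto
    then show ?thesis
      using iso_class_eq_iff[OF kgraph_induced[OF G X]] by blast
  qed
  have "bij_betw ((`) f) (?C G) (?C H)"
    using f by (rule bij_betw_image_subsets) (simp add: card_image inj_on_subset[OF inj])
  then have "mset_set (?C H) = image_mset ((`) f) (mset_set (?C G))"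
    by (simp add: bij_betw_def image_mset_mset_set)
  moreover have "finite (?C G)"
    using G by (auto simp: kgraph_def)
  ultimately show ?thesis
    unfolding induced_deck_def
    by (auto simp: multiset.map_comp o_def iso intro!: image_mset_cong)
qed

text \<open>
  A multiset of invariants \<open>f x\<close> is determined by the multiset of classes \<open>p x\<close>: on the classes
  that occur, \<open>f\<close> and \<open>g\<close> are both induced by one function \<open>D\<close>. That \<open>f\<close> is constant on each
  class of \<open>p\<close> follows by comparing with an element of \<open>N\<close> of the same class.
\<close>

lemma image_mset_eq_transfer:
  assumes eq: "image_mset p M = image_mset q N"
    and imp: "\<And>x y. x \<in># M \<Longrightarrow> y \<in># N \<Longrightarrow> p x = q y \<Longrightarrow> f x = g y"
  shows "image_mset f M = image_mset g N"
proof -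
  define D where "D c = f (SOME x. x \<in># M \<and> p x = c)" for c
  have sets: "p ` set_mset M = q ` set_mset N"
    using eq by (metis set_image_mset)
  have D: "D (q y) = g y" if "y \<in># N" for y
  proof -
    have "\<exists>x. x \<in># M \<and> p x = q y"
      using sets that by (metis imageE imageI)
    then have "(SOME x. x \<in># M \<and> p x = q y) \<in># M \<and> p (SOME x. x \<in># M \<and> p x = q y) = q y"
      by (rule someI_ex)
    then show ?thesis
      unfolding D_def using imp that by blast
  qed
  have D': "D (p x) = f x" if "x \<in># M" for x
  proof -
    have "p x \<in> q ` set_mset N"
      unfolding sets[symmetric] using that by simp
    then obtain y where "y \<in># N" "p x = q y"
      by auto
    then show ?thesis
      using D[of y] imp[OF that, of y] by simp
  qed
  have "image_mset f M = image_mset D (image_mset p M)"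
    using D' by (simp add: multiset.map_comp o_def cong: image_mset_cong)
  also have "\<dots> = image_mset g N"
    unfolding eq using D by (simp add: multiset.map_comp o_def cong: image_mset_cong)
  finally show ?thesis .
qed

text \<open>
  Hypergraphs with equal decks agree in every statistic that sums an isomorphism invariant over
  the cards.
\<close>

lemma induced_deck_eq_transfer:
  assumes H: "kgraph k H1" "kgraph k H2" and eq: "induced_deck H1 t = induced_deck H2 t"
    and inv: "\<And>X Y. X \<subseteq> verts H1 \<Longrightarrow> Y \<subseteq> verts H2 \<Longrightarrow>
       isomorphic (induced H1 X) (induced H2 Y) \<Longrightarrow> f X = g Y"
  shows "image_mset f (mset_set {X. X \<subseteq> verts H1 \<and> card X = t})
       = image_mset g (mset_set {X. X \<subseteq> verts H2 \<and> card X = t})"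
proof (rule image_mset_eq_transfer[OF eq[unfolded induced_deck_def]])
  fix X Y assume XY: "X \<in># mset_set {X. X \<subseteq> verts H1 \<and> card X = t}"
    "Y \<in># mset_set {X. X \<subseteq> verts H2 \<and> card X = t}"
    and iso: "iso_class (induced H1 X) = iso_class (induced H2 Y)"
  have "finite {X. X \<subseteq> verts H1 \<and> card X = t}" "finite {X. X \<subseteq> verts H2 \<and> card X = t}"
    using H by (auto simp: kgraph_def)
  with XY have "X \<subseteq> verts H1" "Y \<subseteq> verts H2"
    by auto
  with iso show "f X = g Y"
    using inv iso_class_eq_iff[OF kgraph_induced[OF H(1)]] by blast
qed

text \<open>
  Kelly's lemma: each \<open>s\<close>-subset of the vertices lies in the same number of \<open>t\<close>-subsets. The count of
  a class \<open>c\<close> on both sides is obtained by exchanging the two choices.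
\<close>

lemma sum_deck_of_deck:
  assumes H: "kgraph k H" and st: "s \<le> t"
  shows "(\<Sum>Z\<in>{Z. Z \<subseteq> verts H \<and> card Z = t}. induced_deck (induced H Z) s)
       = repeat_mset ((card (verts H) - s) choose (t - s)) (induced_deck H s)"
    (is "?l = ?r")
proof (rule multiset_eqI)
  fix c
  have fin: "finite (verts H)"
    using H by (simp add: kgraph_def)
  let ?C = "\<lambda>V r. {Z. Z \<subseteq> V \<and> card Z = r}"
  let ?w = "\<lambda>Y. if iso_class (induced H Y) = c then 1 else 0 :: nat"
  have finC: "finite (?C V r)" if "V \<subseteq> verts H" for V r
    using fin that by (auto intro!: finite_subset[of _ "Pow V"] dest: finite_subset)
  have cnt: "count (image_mset h (mset_set A)) c = (\<Sum>Y\<in>A. if h Y = c then 1 else 0)"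
    if "finite A" for h and A :: "'a set set"
    using that by (simp add: count_image_mset' flip: sum.inter_filter)
       (simp add: sum.inter_filter eq_commute)
  have "count ?l c = (\<Sum>Z\<in>?C (verts H) t. count (induced_deck (induced H Z) s) c)"
    by (simp add: count_sum)
  also have "\<dots> = (\<Sum>Z\<in>?C (verts H) t. \<Sum>Y\<in>{Y\<in>?C (verts H) s. Y \<subseteq> Z}. ?w Y)"
  proof (rule sum.cong[OF refl])
    fix Z assume Z: "Z \<in> ?C (verts H) t"
    have "count (induced_deck (induced H Z) s) c
        = (\<Sum>Y\<in>?C Z s. if iso_class (induced (induced H Z) Y) = c then 1 else 0)"
      unfolding induced_deck_def using Z finC by (subst cnt) (auto simp: induced_def)
    also have "\<dots> = (\<Sum>Y\<in>{Y\<in>?C (verts H) s. Y \<subseteq> Z}. ?w Y)"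
      using Z by (intro sum.cong) (auto simp: induced_induced)
    finally show "count (induced_deck (induced H Z) s) c = \<dots>" .
  qed
  also have "\<dots> = (\<Sum>Y\<in>?C (verts H) s. \<Sum>Z\<in>{Z\<in>?C (verts H) t. Y \<subseteq> Z}. ?w Y)"
    by (rule sum.swap_restrict) (use finC in auto)
  also have "\<dots> = (\<Sum>Y\<in>?C (verts H) s. ((card (verts H) - s) choose (t - s)) * ?w Y)"
  proof (rule sum.cong[OF refl])
    fix Y assume Y: "Y \<in> ?C (verts H) s"
    have "{Z \<in> ?C (verts H) t. Y \<subseteq> Z} = {Z. Y \<subseteq> Z \<and> Z \<subseteq> verts H \<and> card Z = t}"
      by auto
    then have "card {Z \<in> ?C (verts H) t. Y \<subseteq> Z} = (card (verts H) - s) choose (t - s)"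
      using card_intermediate_sets[of "verts H" Y t] fin Y st by simp
    then show "(\<Sum>Z\<in>{Z\<in>?C (verts H) t. Y \<subseteq> Z}. ?w Y) = ((card (verts H) - s) choose (t - s)) * ?w Y"
      by simp
  qed
  also have "\<dots> = count ?r c"
    unfolding induced_deck_def count_repeat_mset using finC by (subst cnt) (auto simp: sum_distrib_left)
  finally show "count ?l c = count ?r c" .
qed

text \<open>
  The multiplicity in Kelly's lemma is nonzero for \<open>s \<le> t \<le> n\<close> and can be cancelled.
\<close>

lemma induced_deck_eq_smaller:
  assumes H: "kgraph k H1" "kgraph k H2" and n: "card (verts H1) = n" "card (verts H2) = n"
    and eq: "induced_deck H1 t = induced_deck H2 t" and "s \<le> t" "t \<le> n"
  shows "induced_deck H1 s = induced_deck H2 s"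
proof -
  have "image_mset (\<lambda>Z. induced_deck (induced H1 Z) s) (mset_set {X. X \<subseteq> verts H1 \<and> card X = t})
      = image_mset (\<lambda>Z. induced_deck (induced H2 Z) s) (mset_set {X. X \<subseteq> verts H2 \<and> card X = t})"
    using H eq
  proof (rule induced_deck_eq_transfer)
    fix X Y assume X: "X \<subseteq> verts H1" and iso: "isomorphic (induced H1 X) (induced H2 Y)"
    show "induced_deck (induced H1 X) s = induced_deck (induced H2 Y) s"
      by (rule induced_deck_isomorphic[OF kgraph_induced[OF H(1) X] iso])
  qed
  then have "(\<Sum>Z\<in>{Z. Z \<subseteq> verts H1 \<and> card Z = t}. induced_deck (induced H1 Z) s)
           = (\<Sum>Z\<in>{Z. Z \<subseteq> verts H2 \<and> card Z = t}. induced_deck (induced H2 Z) s)"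
    unfolding sum_unfold_sum_mset by simp
  then have "repeat_mset ((n - s) choose (t - s)) (induced_deck H1 s)
           = repeat_mset ((n - s) choose (t - s)) (induced_deck H2 s)"
    using sum_deck_of_deck[OF H(1) \<open>s \<le> t\<close>] sum_deck_of_deck[OF H(2) \<open>s \<le> t\<close>] n by simp
  moreover have "(n - s) choose (t - s) \<noteq> 0"
    using assms by simp
  ultimately show ?thesis
    by (simp add: repeat_mset_cancel1)
qed

section \<open>Reconstructing the matching numbers\<close>

text \<open>
  The cards \<open>Y\<close> that see an edge set \<open>S\<close> covering \<open>r\<close> vertices are the \<open>s\<close>-sets between
  \<open>\<Union>(ends H ` S)\<close> and \<open>verts H\<close>, so their number depends on \<open>r\<close> alone.
\<close>

lemma sum_over_levels:
  fixes a :: "'e set \<Rightarrow> real"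
  assumes H: "kgraph k H" and n: "card (verts H) = n"
    and a: "\<And>S. finite S \<Longrightarrow> f S = (\<Sum>T\<in>Pow S. a T)"
  shows "(\<Sum>Y | Y \<subseteq> verts H \<and> card Y = s. f (edges (induced H Y)))
    = (\<Sum>r\<le>s. real ((n - r) choose (s - r)) *
        (\<Sum>S | S \<subseteq> edges H \<and> card (\<Union>(ends H ` S)) = r. a S))"
proof -
  let ?V = "verts H" and ?E = "edges H"
  let ?u = "\<lambda>S. \<Union>(ends H ` S)"
  let ?C = "{Y. Y \<subseteq> ?V \<and> card Y = s}"
  have fin: "finite ?V" "finite ?E"
    using H by (auto simp: kgraph_def)
  have u: "?u S \<subseteq> ?V" if "S \<subseteq> ?E" for S
    using H that by (auto simp: kgraph_def)
  have "(\<Sum>Y\<in>?C. f (edges (induced H Y))) = (\<Sum>Y\<in>?C. \<Sum>S\<in>{S\<in>Pow ?E. ?u S \<subseteq> Y}. a S)"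
    using fin by (intro sum.cong refl, subst a) (auto simp: induced_def intro!: sum.cong)
  also have "\<dots> = (\<Sum>S\<in>Pow ?E. \<Sum>Y\<in>{Y\<in>?C. ?u S \<subseteq> Y}. a S)"
    by (rule sum.swap_restrict) (use fin in auto)
  also have "\<dots> = (\<Sum>S\<in>Pow ?E. if card (?u S) \<le> s
      then real ((n - card (?u S)) choose (s - card (?u S))) * a S else 0)"
  proof (rule sum.cong[OF refl])
    fix S assume "S \<in> Pow ?E"
    then have S: "?u S \<subseteq> ?V"
      using u by blast
    show "(\<Sum>Y\<in>{Y\<in>?C. ?u S \<subseteq> Y}. a S) = (if card (?u S) \<le> s
      then real ((n - card (?u S)) choose (s - card (?u S))) * a S else 0)"
    proof (cases "card (?u S) \<le> s")
      case True
      have "{Y\<in>?C. ?u S \<subseteq> Y} = {Y. ?u S \<subseteq> Y \<and> Y \<subseteq> ?V \<and> card Y = s}"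
        by auto
      then show ?thesis
        using True card_intermediate_sets[OF fin(1) S True] n by simp
    next
      case False
      have none: "{Y\<in>?C. ?u S \<subseteq> Y} = {}"
        using False card_mono[of _ "?u S"] fin(1) finite_subset[of _ ?V] by blast
      show ?thesis
        unfolding none using False by simp
    qed
  qed
  also have "\<dots> = (\<Sum>S\<in>{S\<in>Pow ?E. card (?u S) \<le> s}.
      real ((n - card (?u S)) choose (s - card (?u S))) * a S)"
    by (rule sum.inter_filter[symmetric]) (use fin in simp)
  also have "\<dots> = (\<Sum>r\<le>s. \<Sum>S\<in>{S\<in>{S\<in>Pow ?E. card (?u S) \<le> s}. card (?u S) = r}.
      real ((n - card (?u S)) choose (s - card (?u S))) * a S)"
    by (rule sum.group[symmetric]) (use fin in auto)
  also have "\<dots> = (\<Sum>r\<le>s. real ((n - r) choose (s - r)) * (\<Sum>S | S \<subseteq> ?E \<and> card (?u S) = r. a S))"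
    unfolding sum_distrib_left by (intro sum.cong) auto
  finally show ?thesis .
qed

text \<open>
  Edge sets that cover more than \<open>t\<close> vertices have coefficient 0, so the levels up to \<open>t\<close>
  suffice.
\<close>

lemma log_deriv_nth_eq_sum_levels:
  fixes c :: "'e set \<Rightarrow> real"
  assumes G: "kgraph k G" and k: "k > 0" and t: "(k - 1) * (i + 1) + 1 \<le> t"
    and c: "\<And>S. finite S \<Longrightarrow> log_deriv (ends G) S $ i = (\<Sum>T\<in>Pow S. c T)"
    and c0: "\<And>T. finite T \<Longrightarrow> \<forall>e\<in>T. finite (ends G e) \<and> card (ends G e) = k \<Longrightarrow>
           card (\<Union>(ends G ` T)) > (k - 1) * (i + 1) + 1 \<Longrightarrow> c T = 0"
  shows "log_deriv (ends G) (edges G) $ i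
      = (\<Sum>r\<le>t. \<Sum>S | S \<subseteq> edges G \<and> card (\<Union>(ends G ` S)) = r. c S)"
proof -
  have fin: "finite (edges G)"
    using G by (simp add: kgraph_def)
  have e: "finite (ends G e) \<and> card (ends G e) = k" if "e \<in> edges G" for e
    using G k that by (auto simp: kgraph_def intro: finite_subset)
  have "c S = 0" if "S \<subseteq> edges G" "card (\<Union>(ends G ` S)) > t" for S
    using that t e fin by (intro c0) (auto intro: finite_subset)
  then have "(\<Sum>S\<in>Pow (edges G). c S) = (\<Sum>S\<in>{S\<in>Pow (edges G). card (\<Union>(ends G ` S)) \<le> t}. c S)"
    using fin by (intro sum.mono_neutral_right) (auto simp flip: not_le)
  also have "\<dots> = (\<Sum>r\<le>t. \<Sum>S\<in>{S\<in>{S\<in>Pow (edges G). card (\<Union>(ends G ` S)) \<le> t}.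
      card (\<Union>(ends G ` S)) = r}. c S)"
    by (rule sum.group[symmetric]) (use fin in auto)
  also have "\<dots> = (\<Sum>r\<le>t. \<Sum>S | S \<subseteq> edges G \<and> card (\<Union>(ends G ` S)) = r. c S)"
    by (intro sum.cong) auto
  finally show ?thesis
    using c[OF fin] by simp
qed

lemma num_matchings_isomorphic:
  assumes G: "kgraph k G" and "isomorphic G H"
  shows "num_matchings G i = num_matchings H i"
proof -
  obtain f g where f: "bij_betw f (verts G) (verts H)" and g: "bij_betw g (edges G) (edges H)"
    and fg: "\<And>e. e \<in> edges G \<Longrightarrow> ends H (g e) = f ` ends G e"
    using assms(2) unfolding isomorphic_def by blast
  have injf: "inj_on f (verts G)" and injg: "inj_on g (edges G)"
    using f g by (auto simp: bij_betw_def)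
  have disj: "ends H (g x) \<inter> ends H (g y) = {} \<longleftrightarrow> ends G x \<inter> ends G y = {}"
    if "x \<in> edges G" "y \<in> edges G" for x y
  proof -
    have "f ` (ends G x \<inter> ends G y) = ends H (g x) \<inter> ends H (g y)"
      using inj_on_image_Int[OF injf, of "ends G x" "ends G y"] fg that G
      by (simp add: kgraph_def)
    then show ?thesis
      by (metis image_is_empty)
  qed
  have m: "matching H (g ` M) \<longleftrightarrow> matching G M" if M: "M \<subseteq> edges G" for M
  proof -
    have "g ` M \<subseteq> edges H"
      using g M by (auto simp: bij_betw_def)
    moreover have "g x = g y \<longleftrightarrow> x = y" if "x \<in> M" "y \<in> M" for x y
      using injg M that by (auto dest: inj_onD)
    ultimately show ?thesis
      using M disj by (auto simp: matching_def disjoint_family_on_def subset_iff)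
  qed
  have "bij_betw ((`) g) {M. M \<subseteq> edges G \<and> matching G M \<and> card M = i}
      {M. M \<subseteq> edges H \<and> matching H M \<and> card M = i}"
    using g by (rule bij_betw_image_subsets) (simp add: m card_image inj_on_subset[OF injg])
  then have "card {M. M \<subseteq> edges G \<and> matching G M \<and> card M = i}
      = card {M. M \<subseteq> edges H \<and> matching H M \<and> card M = i}"
    by (rule bij_betw_same_card)
  moreover have "{M. M \<subseteq> edges G \<and> matching G M \<and> card M = i} = {M. matching G M \<and> card M = i}"
    "{M. M \<subseteq> edges H \<and> matching H M \<and> card M = i} = {M. matching H M \<and> card M = i}"
    by (auto simp: matching_def)
  ultimately show ?thesis
    unfolding num_matchings_def by simp
qed

lemma log_deriv_isomorphic:
  assumes "kgraph k G" "kgraph k H" "isomorphic G H"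
  shows "log_deriv (ends G) (edges G) = log_deriv (ends H) (edges H)"
proof -
  have "match_fps (ends G) (edges G) = match_fps (ends H) (edges H)"
    using assms num_matchings_isomorphic[OF assms(1,3)]
    by (simp add: fps_eq_iff kgraph_def flip: num_matchings_eq_match_fps_nth)
  then show ?thesis
    by (simp add: log_deriv_def)
qed

lemma log_deriv_nth_reconstruct:
  assumes H: "kgraph k H1" "kgraph k H2" and n: "card (verts H1) = n" "card (verts H2) = n"
    and eq: "induced_deck H1 t = induced_deck H2 t" and t: "t \<le> n"
    and i: "(k - 1) * (i + 1) + 1 \<le> t" and k: "k > 0"
  shows "log_deriv (ends H1) (edges H1) $ i = log_deriv (ends H2) (edges H2) $ i"
proof -
  obtain a where a: "\<And>S. finite S \<Longrightarrow> log_deriv (ends H1) S $ i = (\<Sum>T\<in>Pow S. a T)"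
    and a0: "\<And>T. finite T \<Longrightarrow> \<forall>e\<in>T. finite (ends H1 e) \<and> card (ends H1 e) = k \<Longrightarrow>
           card (\<Union>(ends H1 ` T)) > (k - 1) * (i + 1) + 1 \<Longrightarrow> a T = 0"
    using log_deriv_coefficients[of "ends H1" i k] by blast
  obtain b where b: "\<And>S. finite S \<Longrightarrow> log_deriv (ends H2) S $ i = (\<Sum>T\<in>Pow S. b T)"
    and b0: "\<And>T. finite T \<Longrightarrow> \<forall>e\<in>T. finite (ends H2 e) \<and> card (ends H2 e) = k \<Longrightarrow>
           card (\<Union>(ends H2 ` T)) > (k - 1) * (i + 1) + 1 \<Longrightarrow> b T = 0"
    using log_deriv_coefficients[of "ends H2" i k] by blast
  define A where "A r = (\<Sum>S | S \<subseteq> edges H1 \<and> card (\<Union>(ends H1 ` S)) = r. a S)" for r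
  define B where "B r = (\<Sum>S | S \<subseteq> edges H2 \<and> card (\<Union>(ends H2 ` S)) = r. b S)" for r
  have lev: "(\<Sum>r\<le>s. real ((n - r) choose (s - r)) * A r) = (\<Sum>r\<le>s. real ((n - r) choose (s - r)) * B r)"
    if "s \<le> t" for s
  proof -
    let ?L1 = "\<lambda>Y. log_deriv (ends H1) (edges (induced H1 Y)) $ i"
    let ?L2 = "\<lambda>Y. log_deriv (ends H2) (edges (induced H2 Y)) $ i"
    have "image_mset ?L1 (mset_set {Y. Y \<subseteq> verts H1 \<and> card Y = s})
        = image_mset ?L2 (mset_set {Y. Y \<subseteq> verts H2 \<and> card Y = s})"
      using H induced_deck_eq_smaller[OF H n eq that t]
    proof (rule induced_deck_eq_transfer)
      fix X Y assume "X \<subseteq> verts H1" "Y \<subseteq> verts H2" "isomorphic (induced H1 X) (induced H2 Y)"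
      then have "log_deriv (ends (induced H1 X)) (edges (induced H1 X))
               = log_deriv (ends (induced H2 Y)) (edges (induced H2 Y))"
        using H by (intro log_deriv_isomorphic kgraph_induced)
      then show "?L1 X = ?L2 Y"
        by (simp add: induced_def)
    qed
    then have "(\<Sum>Y | Y \<subseteq> verts H1 \<and> card Y = s. ?L1 Y) = (\<Sum>Y | Y \<subseteq> verts H2 \<and> card Y = s. ?L2 Y)"
      unfolding sum_unfold_sum_mset by simp
    then show ?thesis
      using sum_over_levels[OF H(1) n(1) a] sum_over_levels[OF H(2) n(2) b] by (simp add: A_def B_def)
  qed
  \<comment> \<open>The system \<open>lev\<close> is triangular with \<open>(n - r) choose 0 = 1\<close> on the diagonal.\<close>
  have AB: "A r = B r" if "r \<le> t" for r
    using that
  proof (induction r rule: less_induct)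
    case (less r)
    have "A r + (\<Sum>q<r. real ((n - q) choose (r - q)) * A q)
        = B r + (\<Sum>q<r. real ((n - q) choose (r - q)) * B q)"
      using lev[OF less.prems] by (simp add: lessThan_Suc_atMost[symmetric])
    moreover have "(\<Sum>q<r. real ((n - q) choose (r - q)) * A q)
        = (\<Sum>q<r. real ((n - q) choose (r - q)) * B q)"
      using less by (intro sum.cong) auto
    ultimately show ?case
      by simp
  qed
  have "log_deriv (ends H1) (edges H1) $ i = (\<Sum>r\<le>t. A r)"
    unfolding A_def using H(1) k i a a0 by (rule log_deriv_nth_eq_sum_levels)
  also have "\<dots> = (\<Sum>r\<le>t. B r)"
    using AB by (intro sum.cong) auto
  also have "\<dots> = log_deriv (ends H2) (edges H2) $ i"
    unfolding B_def using H(2) k i b b0 by (rule log_deriv_nth_eq_sum_levels[symmetric])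
  finally show ?thesis .
qed

theorem theorem1p4:
  fixes k n :: nat
    and H1 :: "('v, 'e) hypergraph" and H2 :: "('w, 'f) hypergraph"
  assumes "k \<ge> 2"
    and "kgraph k H1" and "card (verts H1) = n"
    and "kgraph k H2" and "card (verts H2) = n"
    and "induced_deck H1 (((k - 1) * n) div k + 1) = induced_deck H2 (((k - 1) * n) div k + 1)"
  shows "matching_poly k H1 = matching_poly k H2"
proof -
  let ?t = "((k - 1) * n) div k + 1"
  let ?P = "\<lambda>G. match_fps (ends G) (edges G)" and ?L = "\<lambda>G. log_deriv (ends G) (edges G)"
  have fin: "finite (edges H1)" "finite (edges H2)"
    using assms by (auto simp: kgraph_def)
  \<comment> \<open>Here the size of the cards enters: \<open>j + 1 \<le> n / k\<close> makes the \<open>(k - 1) * (j + 1) + 1\<close> vertices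
      of a connected set of \<open>j + 1\<close> edges fit into one card. It also excludes \<open>n = 0\<close>, where
      there are no cards at all.\<close>
  have L: "?L H1 $ j = ?L H2 $ j" if j: "j + 1 \<le> n div k" for j
  proof (rule log_deriv_nth_reconstruct[of k H1 H2 n ?t j])
    have mult_le: "(j + 1) * k \<le> n"
      using j assms(1) by (simp add: less_eq_div_iff_mult_less_eq)
    then have "n > 0"
      using assms(1) by (cases n) auto
    then have "(k - 1) * n < n * k"
      using assms(1) by (simp add: mult.commute)
    then have "((k - 1) * n) div k < n"
      using assms(1) by (simp add: div_less_iff_less_mult)
    then show "?t \<le> n"
      by simp
    have "(k - 1) * (j + 1) * k \<le> (k - 1) * n"
      using mult_le_mono2[OF mult_le, of "k - 1"] by (simp only: mult.assoc)
    then have "(k - 1) * (j + 1) \<le> ((k - 1) * n) div k"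
      using assms(1) by (simp add: less_eq_div_iff_mult_less_eq del: mult_Suc_right)
    then show "(k - 1) * (j + 1) + 1 \<le> ?t"
      by simp
  qed (use assms in auto)
  have P: "?P H1 $ m = ?P H2 $ m" if "m \<le> n div k" for m
    using that
  proof (induction m rule: less_induct)
    case (less m)
    show ?case
    proof (cases m)
      case 0
      then show ?thesis
        using fin by simp
    next
      case (Suc j)
      have "(\<Sum>q<j. ?L H1 $ q * ?P H1 $ (j - q)) = (\<Sum>q<j. ?L H2 $ q * ?P H2 $ (j - q))"
        using less Suc L by (intro sum.cong) auto
      moreover have "?L H1 $ j = ?L H2 $ j"
        using L[of j] less.prems Suc by simp
      ultimately have "real (j + 1) * ?P H1 $ (j + 1) = real (j + 1) * ?P H2 $ (j + 1)"
        unfolding match_fps_recurrence[OF fin(1)] match_fps_recurrence[OF fin(2)] by simp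
      then show ?thesis
        using Suc by simp
    qed
  qed
  have "num_matchings H1 m = num_matchings H2 m" if "m \<le> n div k" for m
    using P[OF that] fin by (simp flip: num_matchings_eq_match_fps_nth)
  then show ?thesis
    unfolding matching_poly_def using assms by simp
qed

end
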